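(* Let $\mathcal{H}$ be a separable Hilbert space and let $\mathcal{F}=\{f_k\}_{k=1}^\infty$ be a Bessel sequence in $\mathcal{H}$ with bound $B$. Suppose that the infinite matrix $E=(E_{n,k})_{n,k\geq1}$ is a matrix mapping on $\bigoplus_{n=1}^\infty\mathcal{H}$. Then $\mathcal{F}$ is an $E$-Bessel sequence with bound $\|\bar{E}\|^2B$; that is, the series $(E\mathcal{F})_n=\sum_{k=1}^\infty E_{n,k}f_k$ converges in $\mathcal{H}$ for every $n$, and $\sum_{n=1}^\infty|\langle f,(E\mathcal{F})_n\rangle|^2\le\|\bar{E}\|^2B\|f\|^2$ for all $f\in\mathcal{H}$.
   Context: Matrices have real or complex entries (scalars of the Hilbert space). $\bigoplus_{n=1}^\infty\mathcal{H}$ is the Hilbert space of sequences $\{f_n\}_{n=1}^\infty$ in $\mathcal{H}$ with $\sum_n\|f_n\|^2<\infty$. $E$ is (defines) a matrix mapping on a sequence space $\mathcal X$ if for every $x=\{x_k\}\in\mathcal X$ the series $(Ex)_n=\sum_{k=1}^\infty E_{n,k}x_k$ converges for every $n$ and $Ex=\{(Ex)_n\}_{n}\in\mathcal X$. $\{f_k\}$ is a Bessel sequence with bound $B$ if $\sum_k|\langle f,f_k\rangle|^2\le B\|f\|^2$ for all $f\in\mathcal{H}$. $\mathcal{F}$ is an $E$-Bessel sequence with bound $B'$ if $E\mathcal{F}$ is well defined and $\sum_n|\langle f,(E\mathcal{F})_n\rangle|^2\le B'\|f\|^2$ for all $f\in\mathcal{H}$. $\bar{E}=(\overline{E_{n,k}})_{n,k\ge1}$,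 and $\|\bar E\|$ is the norm of the bounded operator $c\mapsto\bar{E}c$ which $\bar E$ induces on $\ell^2(\mathbb{N})$. *)

theory Defs
  imports "HOL-Analysis.Analysis"
begin

text \<open>
  The class of admissible scalar fields. The only models are the real and the complex numbers
  with their usual absolute value and conjugation: see the two instances and the
  lemma \<open>real_or_complex_cases\<close>.
\<close>

class real_or_complex = real_normed_field +
  fixes sconj :: "'a \<Rightarrow> 'a"
  assumes sconj_add: "sconj (x + y) = sconj x + sconj y"
    and mult_sconj_scaleR: "x * sconj x = (norm x)\<^sup>2 *\<^sub>R 1"

instantiation real :: real_or_complex
begin
definition sconj_real :: "real \<Rightarrow> real" where "sconj_real x = x"
instance by standard (simp_all add: sconj_real_def power2_eq_square)
end

instantiation complex :: real_or_complex
begin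
definition sconj_complex :: "complex \<Rightarrow> complex" where "sconj_complex = cnj"
instance by standard
    (simp_all add: sconj_complex_def scaleR_conv_of_real complex_norm_square del: of_real_power)
end

lemma mult_sconj: "x * sconj x = of_real ((norm (x :: 'k::real_or_complex))\<^sup>2)"
  by (simp add: mult_sconj_scaleR of_real_def)

lemma sconj_of_real: "sconj (of_real r :: 'k::real_or_complex) = of_real r"
proof (cases "r = 0")
  case True
  have "sconj (0 + 0 :: 'k) = sconj 0 + sconj 0" by (rule sconj_add)
  with True show ?thesis by simp
next
  case False
  have "of_real r * sconj (of_real r :: 'k) = of_real r * of_real r"
    by (simp add: mult_sconj power2_eq_square)
  with False show ?thesis by simp
qed

lemma sconj_mult: "sconj (x * y :: 'k::real_or_complex) = sconj x * sconj y"
proof (cases "x * y = 0")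
  case True
  then show ?thesis using sconj_of_real[of 0, where 'k='k] by auto
next
  case False
  have "(x * y) * sconj (x * y) = (x * sconj x) * (y * sconj y)"
    by (simp add: mult_sconj norm_mult power_mult_distrib)
  also have "\<dots> = (x * y) * (sconj x * sconj y)" by (simp add: mult_ac)
  finally show ?thesis using False by simp
qed

lemma add_sconj_in_Reals: "(x :: 'k::real_or_complex) + sconj x \<in> \<real>"
proof -
  have "(x + 1) * sconj (x + 1) = x * sconj x + (x + sconj x) + 1"
    using sconj_of_real[of 1, where 'k='k] by (simp add: sconj_add algebra_simps)
  then have "x + sconj x = of_real ((norm (x + 1))\<^sup>2 - (norm x)\<^sup>2 - 1)"
    unfolding mult_sconj by (simp add: algebra_simps)
  then show ?thesis by (metis Reals_of_real)
qed

lemma sconj_minus: "sconj (- x :: 'k::real_or_complex) = - sconj x"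
  using sconj_mult[of "-1" x] sconj_of_real[of "-1", where 'k='k] by simp

lemma sconj_conj: "sconj (sconj (x :: 'k::real_or_complex)) = x"
proof -
  obtain r where "x + sconj x = of_real r" using add_sconj_in_Reals[of x] by (auto simp: Reals_def)
  then have eq: "sconj x = of_real r + - x" by (simp add: algebra_simps)
  have "sconj (sconj x) = of_real r + - sconj x"
    by (subst eq) (simp only: sconj_add sconj_minus sconj_of_real)
  with eq show ?thesis by simp
qed

lemma real_or_complex_cases:
  "(UNIV :: 'k::real_or_complex set) = \<real> \<or>
    (\<exists>j :: 'k. j * j = - 1 \<and> sconj j = - j \<and> (\<forall>x. \<exists>a b. x = of_real a + of_real b * j))"
proof (rule disjCI)
  assume "\<not> (\<exists>j :: 'k. j * j = - 1 \<and> sconj j = - j \<and> (\<forall>x. \<exists>a b. x = of_real a + of_real b * j))"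
  then have no: "\<And>j :: 'k. \<lbrakk>j * j = - 1; sconj j = - j\<rbrakk> \<Longrightarrow> \<exists>x. \<forall>a b. x \<noteq> of_real a + of_real b * j"
    by blast
  have sconj_half: "sconj (z / 2) = sconj z / 2" for z :: 'k
    using sconj_mult[of z "of_real (1/2)"] by (simp add: sconj_of_real del: of_real_divide) simp
  have half: "z = (z + sconj z) / 2 + (z + - sconj z) / 2"
    "sconj ((z + - sconj z) / 2) = - ((z + - sconj z) / 2)" for z :: 'k
    unfolding sconj_half sconj_add sconj_minus sconj_conj by (simp_all add: field_simps)
  have fixed: "x \<in> \<real>" if "sconj x = x" for x :: 'k
  proof -
    have "x = (x + sconj x) / 2" using that by simp
    then show ?thesis using add_sconj_in_Reals[of x] by (metis Reals_divide Reals_numeral)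
  qed
  have re: "(z + sconj z) / 2 \<in> \<real>" for z :: 'k
    using add_sconj_in_Reals[of z] by (metis Reals_divide Reals_numeral)
  have "x \<in> \<real>" for x :: 'k
  proof (rule ccontr)
    assume x: "x \<notin> \<real>"
    define y where "y = (x + - sconj x) / 2"
    have cy: "sconj y = - y" unfolding y_def by (rule half)
    have y0: "y \<noteq> 0"
      using x half(1)[of x] re[of x] unfolding y_def by auto
    define j where "j = of_real (inverse (norm y)) * y"
    have cj: "sconj j = - j" by (simp add: j_def sconj_mult sconj_of_real cy del: of_real_inverse)
    have "norm j = 1" using y0 by (simp add: j_def norm_mult norm_inverse)
    then have "j * sconj j = 1" by (simp add: mult_sconj)
    then have "- (j * j) = 1" by (simp add: cj)
    then have jj: "j * j = - 1" by (metis add.inverse_inverse)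
    obtain z where z: "\<And>a b. z \<noteq> of_real a + of_real b * j" using no[OF jj cj] by blast
    define w where "w = (z + - sconj z) / 2"
    have cw: "sconj w = - w" unfolding w_def by (rule half)
    have "sconj (w * j) = w * j" by (simp add: sconj_mult cj cw)
    then obtain b where b: "w * j = of_real b" using fixed by (auto simp: Reals_def)
    have "w = - (w * j) * j" using jj by (simp add: mult.assoc)
    then have "w = of_real (- b) * j" using b by simp
    moreover obtain a where "(z + sconj z) / 2 = of_real a" using re[of z] by (auto simp: Reals_def)
    ultimately show False using z half(1)[of z] unfolding w_def by metis
  qed
  then show "(UNIV :: 'k set) = \<real>" by auto
qed

text \<open>
  A Hilbert space over either scalar field. Its real vector space structure, norm and
  completeness are those of class \<^class>\<open>banach\<close>; the inner product is linear in the first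
  argument, and positive definiteness is contained in \<open>ip_norm\<close>.
\<close>

locale hilbert_space = vector_space sc
  for sc :: "'k::real_or_complex \<Rightarrow> 'h::banach \<Rightarrow> 'h" +
  fixes ip :: "'h \<Rightarrow> 'h \<Rightarrow> 'k"
  assumes scale_of_real: "sc (of_real r) x = r *\<^sub>R x"
    and ip_add_left: "ip (x + y) z = ip x z + ip y z"
    and ip_scale_left: "ip (sc a x) y = a * ip x y"
    and ip_sconj: "ip y x = sconj (ip x y)"
    and ip_norm: "ip x x = of_real ((norm x)\<^sup>2)"

lemma real_hilbert_space:
  "hilbert_space (scaleR :: real \<Rightarrow> 'h \<Rightarrow> 'h::{real_inner, banach}) inner"
  by unfold_locales
    (simp_all add: sconj_real_def inner_add_left inner_commute power2_norm_eq_inner algebra_simps)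

lemma complex_hilbert_space: "hilbert_space (*) (\<lambda>x y :: complex. x * cnj y)"
  by unfold_locales
    (simp_all add: sconj_complex_def scaleR_conv_of_real complex_norm_square algebra_simps
      del: of_real_power)

text \<open>
  Sequences and matrices are indexed from 0. Depending on the type, \<open>l2_space\<close> is the Hilbert
  direct sum of countably many copies of a Hilbert space, or the space of square-summable scalar
  sequences.
\<close>

definition l2_space :: "(nat \<Rightarrow> 'h::real_normed_vector) set" where
  "l2_space = {x. summable (\<lambda>n. (norm (x n))\<^sup>2)}"

definition l2_norm :: "(nat \<Rightarrow> 'h::real_normed_vector) \<Rightarrow> real" where
  "l2_norm x = sqrt (\<Sum>n. (norm (x n))\<^sup>2)"

definition matrix_defined ::
  "('k \<Rightarrow> 'h \<Rightarrow> 'h::real_normed_vector) \<Rightarrow> (nat \<Rightarrow> nat \<Rightarrow> 'k) \<Rightarrow> (nat \<Rightarrow> 'h) \<Rightarrow> bool" where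
  "matrix_defined sc E x \<longleftrightarrow> (\<forall>n. summable (\<lambda>k. sc (E n k) (x k)))"

definition matrix_apply ::
  "('k \<Rightarrow> 'h \<Rightarrow> 'h::real_normed_vector) \<Rightarrow> (nat \<Rightarrow> nat \<Rightarrow> 'k) \<Rightarrow> (nat \<Rightarrow> 'h) \<Rightarrow> nat \<Rightarrow> 'h" where
  "matrix_apply sc E x n = (\<Sum>k. sc (E n k) (x k))"

definition matrix_mapping_on ::
  "('k \<Rightarrow> 'h \<Rightarrow> 'h::real_normed_vector) \<Rightarrow> (nat \<Rightarrow> nat \<Rightarrow> 'k) \<Rightarrow> (nat \<Rightarrow> 'h) set \<Rightarrow> bool" where
  "matrix_mapping_on sc E X \<longleftrightarrow>
    (\<forall>x\<in>X. matrix_defined sc E x \<and> matrix_apply sc E x \<in> X)"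

definition conj_matrix :: "(nat \<Rightarrow> nat \<Rightarrow> 'k::real_or_complex) \<Rightarrow> nat \<Rightarrow> nat \<Rightarrow> 'k" where
  "conj_matrix E n k = sconj (E n k)"

definition l2_bounded_matrix :: "(nat \<Rightarrow> nat \<Rightarrow> 'k::real_normed_field) \<Rightarrow> bool" where
  "l2_bounded_matrix A \<longleftrightarrow>
    matrix_mapping_on (*) A l2_space \<and>
    (\<exists>M. \<forall>c\<in>l2_space. l2_norm (matrix_apply (*) A c) \<le> M * l2_norm c)"

text \<open>The supremum is the operator norm only if \<^term>\<open>l2_bounded_matrix A\<close> holds.\<close>

definition l2_matrix_norm :: "(nat \<Rightarrow> nat \<Rightarrow> 'k::real_normed_field) \<Rightarrow> real" where
  "l2_matrix_norm A = (SUP c\<in>{c \<in> l2_space. l2_norm c \<le> 1}. l2_norm (matrix_apply (*) A c))"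

definition bessel_sequence ::
  "('h \<Rightarrow> 'h \<Rightarrow> 'k::real_normed_field) \<Rightarrow> (nat \<Rightarrow> 'h::real_normed_vector) \<Rightarrow> real \<Rightarrow> bool" where
  "bessel_sequence ip F B \<longleftrightarrow>
    (\<forall>f. summable (\<lambda>k. (norm (ip f (F k)))\<^sup>2) \<and>
         (\<Sum>k. (norm (ip f (F k)))\<^sup>2) \<le> B * (norm f)\<^sup>2)"

definition E_bessel_sequence ::
  "('k \<Rightarrow> 'h \<Rightarrow> 'h) \<Rightarrow> ('h \<Rightarrow> 'h \<Rightarrow> 'k::real_normed_field) \<Rightarrow> (nat \<Rightarrow> nat \<Rightarrow> 'k)
    \<Rightarrow> (nat \<Rightarrow> 'h::real_normed_vector) \<Rightarrow> real \<Rightarrow> bool" where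
  "E_bessel_sequence sc ip E F B \<longleftrightarrow>
    matrix_defined sc E F \<and> bessel_sequence ip (matrix_apply sc E F) B"

end

theory Submission
  imports Defs
begin

text \<open>
  Pairing \<open>f\<close> with \<open>(E F)\<^sub>n = \<Sum>\<^sub>k E\<^sub>n\<^sub>k F\<^sub>k\<close> moves the conjugates of the entries of \<open>E\<close> out of the inner
  product: the coefficients of \<open>f\<close> with respect to \<open>E F\<close> are the image under the conjugate matrix of
  its coefficients with respect to \<open>F\<close>. The Bessel bound for \<open>F\<close> and the norm of the conjugate matrix
  then multiply to the asserted bound. Two points need an argument: that the conjugate matrix is
  bounded on the scalar sequence space, and that the series for \<open>(E F)\<^sub>n\<close> converges.

  Boundedness is a closed-graph phenomenon: a matrix that is defined on all square-summable
  sequences of vectors and maps them to such sequences is bounded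
  (\<open>matrix_mapping_bounded\<close>). It follows from a uniform boundedness principle for countable families
  of seminorms on the direct sum (\<open>l2_uniform_boundedness\<close>), whose proof uses completeness only
  through series with geometrically decreasing terms. Working with vector-valued sequences makes
  the completeness of the Hilbert space available and leaves the scalar case as a corollary: if
  \<open>u\<close> is a unit vector, then \<open>E\<close> acts on the sequences \<open>(c\<^sub>k u)\<^sub>k\<close> as it acts on the scalar sequences
  \<open>c\<close> (\<open>scalar_matrix_l2_bounded\<close>), and conjugating the argument and the value transfers the bound to the
  conjugate matrix (\<open>l2_bounded_matrix_conj\<close>).

  For the convergence, a bounded matrix has square-summable rows (\<open>l2_bounded_matrix_rows\<close>), and the
  synthesis operator of a Bessel sequence turns square-summable coefficients into convergent
  series (\<open>bessel_synthesis_summable\<close>).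

  In the zero space there is no unit vector, and \<open>E\<close> can be arbitrary; there all series and
  coefficients vanish, so the Bessel inequality is trivial.
\<close>

section \<open>Square-summable sequences\<close>

lemma l2_norm_le_iff_finite:
  fixes x :: "nat \<Rightarrow> 'h::real_normed_vector"
  shows "x \<in> l2_space \<and> l2_norm x \<le> C \<longleftrightarrow> (\<forall>K. L2_set (\<lambda>k. norm (x k)) {..<K} \<le> C)"
proof
  assume "x \<in> l2_space \<and> l2_norm x \<le> C"
  then have s: "summable (\<lambda>k. (norm (x k))\<^sup>2)" and C: "sqrt (\<Sum>k. (norm (x k))\<^sup>2) \<le> C"
    by (auto simp: l2_space_def l2_norm_def)
  have "L2_set (\<lambda>k. norm (x k)) {..<K} \<le> sqrt (\<Sum>k. (norm (x k))\<^sup>2)" for K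
    unfolding L2_set_def by (intro real_sqrt_le_mono sum_le_suminf s) auto
  with C show "\<forall>K. L2_set (\<lambda>k. norm (x k)) {..<K} \<le> C"
    using order_trans by blast
next
  assume le: "\<forall>K. L2_set (\<lambda>k. norm (x k)) {..<K} \<le> C"
  then have C: "0 \<le> C" by (metis L2_set_nonneg order_trans)
  have fin: "(\<Sum>k<K. (norm (x k))\<^sup>2) \<le> C\<^sup>2" for K
    using le C by (metis L2_set_def real_sqrt_le_iff real_sqrt_unique)
  have s: "summable (\<lambda>k. (norm (x k))\<^sup>2)"
    by (rule summableI_nonneg_bounded[where x = "C\<^sup>2"]) (use fin in auto)
  have "(\<Sum>k. (norm (x k))\<^sup>2) \<le> C\<^sup>2"
    by (rule suminf_le_const[OF s fin])
  with s C show "x \<in> l2_space \<and> l2_norm x \<le> C"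
    by (auto simp: l2_space_def l2_norm_def real_le_lsqrt suminf_nonneg)
qed

lemma l2_normI:
  assumes "\<And>K. L2_set (\<lambda>k. norm (x k)) {..<K} \<le> C"
  shows "x \<in> l2_space" "l2_norm x \<le> C"
  using assms l2_norm_le_iff_finite[of x C] by auto

lemma L2_set_le_l2_norm:
  assumes "x \<in> l2_space"
  shows "L2_set (\<lambda>k. norm (x k)) {..<K} \<le> l2_norm x"
  using assms l2_norm_le_iff_finite[of x "l2_norm x"] by auto

lemma l2_norm_nonneg: "x \<in> l2_space \<Longrightarrow> 0 \<le> l2_norm x"
  by (simp add: l2_norm_def l2_space_def suminf_nonneg)

lemma norm_le_l2_norm:
  assumes "x \<in> l2_space"
  shows "norm (x k) \<le> l2_norm x"
proof -
  have "norm (x k) \<le> L2_set (\<lambda>k. norm (x k)) {..<Suc k}"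
    by (rule member_le_L2_set) auto
  with L2_set_le_l2_norm[OF assms, of "Suc k"] show ?thesis by linarith
qed

lemma l2_norm_cong:
  assumes "\<And>k. norm (x k) = norm (y k)"
  shows "x \<in> l2_space \<longleftrightarrow> y \<in> l2_space" "l2_norm x = l2_norm y"
  using assms by (simp_all add: l2_space_def l2_norm_def)

lemma l2_norm_triangle:
  assumes "x \<in> l2_space" "y \<in> l2_space"
  shows "(\<lambda>k. x k + y k) \<in> l2_space" "l2_norm (\<lambda>k. x k + y k) \<le> l2_norm x + l2_norm y"
proof -
  have "L2_set (\<lambda>k. norm (x k + y k)) {..<K} \<le> l2_norm x + l2_norm y" for K
  proof -
    have "L2_set (\<lambda>k. norm (x k + y k)) {..<K} \<le> L2_set (\<lambda>k. norm (x k) + norm (y k)) {..<K}"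
      by (intro L2_set_mono norm_triangle_ineq) auto
    also have "\<dots> \<le> L2_set (\<lambda>k. norm (x k)) {..<K} + L2_set (\<lambda>k. norm (y k)) {..<K}"
      by (rule L2_set_triangle_ineq)
    finally show ?thesis
      using assms[THEN L2_set_le_l2_norm, of K] by linarith
  qed
  then show "(\<lambda>k. x k + y k) \<in> l2_space" "l2_norm (\<lambda>k. x k + y k) \<le> l2_norm x + l2_norm y"
    by (auto intro: l2_normI)
qed

lemma l2_norm_homogeneous:
  assumes "x \<in> l2_space" "\<And>k. norm (y k) = r * norm (x k)" "0 \<le> r"
  shows "y \<in> l2_space" "l2_norm y = r * l2_norm x"
proof -
  have s: "summable (\<lambda>k. (norm (x k))\<^sup>2)" using assms(1) by (simp add: l2_space_def)
  show "y \<in> l2_space" using s by (simp add: l2_space_def assms(2) power_mult_distrib)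
  show "l2_norm y = r * l2_norm x"
    using s assms(3) by (simp add: l2_norm_def assms(2) power_mult_distrib suminf_mult real_sqrt_mult)
qed

text \<open>
  Completeness, in the only form needed: a sequence with absolutely summable increments has a
  limit, with the expected rate. Coordinates converge because they are dominated by the norm, and
  every finite section of the norm passes to the limit.
\<close>

lemma l2_limit_of_summable_increments:
  fixes X :: "nat \<Rightarrow> nat \<Rightarrow> 'h::banach"
  assumes X: "\<And>n. X n \<in> l2_space"
    and inc: "\<And>n. l2_norm (\<lambda>k. X (Suc n) k - X n k) \<le> r n"
    and r: "summable r"
  shows "\<exists>x\<in>l2_space. \<forall>n. (\<lambda>k. x k - X n k) \<in> l2_space \<and> l2_norm (\<lambda>k. x k - X n k) \<le> (\<Sum>j. r (j + n))"
proof -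
  have neg: "(\<lambda>k. - y k) \<in> l2_space" if "y \<in> l2_space" for y :: "nat \<Rightarrow> 'h"
    using that l2_norm_cong(1)[of "\<lambda>k. - y k" y] by simp
  have diff: "(\<lambda>k. X m k - X n k) \<in> l2_space" for m n
    using l2_norm_triangle(1)[OF X[of m] neg[OF X[of n]]] by simp
  have r0: "0 \<le> r n" for n using inc[of n] l2_norm_nonneg[OF diff] order_trans by blast
  have block: "l2_norm (\<lambda>k. X (m + n) k - X n k) \<le> (\<Sum>j<m. r (j + n))" for m n
  proof (induction m)
    case 0 show ?case by (simp add: l2_norm_def)
  next
    case (Suc m)
    have "l2_norm (\<lambda>k. X (Suc m + n) k - X n k)
        \<le> l2_norm (\<lambda>k. X (Suc (m + n)) k - X (m + n) k) + l2_norm (\<lambda>k. X (m + n) k - X n k)"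
      using l2_norm_triangle(2)[OF diff[of "Suc (m + n)" "m + n"] diff[of "m + n" n]] by simp
    with Suc inc[of "m + n"] show ?case by simp
  qed
  have "convergent (\<lambda>n. X n k)" for k
  proof -
    have "summable (\<lambda>n. X (Suc n) k - X n k)"
      by (rule summable_comparison_test'[OF r, of 0])
        (use norm_le_l2_norm[OF diff] inc order_trans in blast)
    then have "convergent (\<lambda>n. X n k - X 0 k)"
      by (simp only: summable_iff_convergent sum_lessThan_telescope[of "\<lambda>n. X n k"])
    then have "convergent (\<lambda>n. (X n k - X 0 k) + X 0 k)"
      by (intro convergent_add convergent_const)
    then show ?thesis by simp
  qed
  then obtain x where x: "\<And>k. (\<lambda>n. X n k) \<longlonglongrightarrow> x k"
    unfolding convergent_def by metis
  have "L2_set (\<lambda>k. norm (x k - X n k)) {..<K} \<le> (\<Sum>j. r (j + n))" for n K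
  proof (rule LIMSEQ_le_const2)
    show "(\<lambda>m. L2_set (\<lambda>k. norm (X (m + n) k - X n k)) {..<K})
        \<longlonglongrightarrow> L2_set (\<lambda>k. norm (x k - X n k)) {..<K}"
      unfolding L2_set_def by (intro tendsto_intros LIMSEQ_ignore_initial_segment x)
    have "L2_set (\<lambda>k. norm (X (m + n) k - X n k)) {..<K} \<le> (\<Sum>j. r (j + n))" for m
    proof -
      have "L2_set (\<lambda>k. norm (X (m + n) k - X n k)) {..<K} \<le> (\<Sum>j<m. r (j + n))"
        using L2_set_le_l2_norm[OF diff] block order_trans by blast
      also have "\<dots> \<le> (\<Sum>j. r (j + n))"
        by (intro sum_le_suminf) (use r r0 in \<open>auto simp: summable_iff_shift\<close>)
      finally show ?thesis .
    qed
    then show "\<exists>N. \<forall>m\<ge>N. L2_set (\<lambda>k. norm (X (m + n) k - X n k)) {..<K} \<le> (\<Sum>j. r (j + n))"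
      by blast
  qed
  note lim = l2_normI[OF this]
  have "x \<in> l2_space"
    using l2_norm_triangle(1)[OF lim(1)[of 0] X[of 0]] by simp
  with lim show ?thesis by blast
qed

section \<open>Uniform boundedness and boundedness of matrix mappings\<close>

text \<open>
  This is the uniform boundedness principle, proved by Sokal's argument. If the norms
  \<open>N i\<close> of the seminorms were unbounded, choose indices \<open>\<iota> n\<close> with \<open>N (\<iota> n) > 4 ^ n\<close> and almost
  norming vectors \<open>w n\<close> in the unit ball. As one of \<open>p (x + y)\<close> and \<open>p (x - y)\<close> is at least
  \<open>p y\<close>, signs can be chosen so that the partial sums of the series of \<open>\<plusminus> w n / 3 ^ n\<close> are large
  for \<open>p (\<iota> n)\<close> right after the summand number \<open>n\<close>; the tail is too small to spoil this, so the sum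
  of the series contradicts pointwise boundedness.
\<close>

lemma l2_uniform_boundedness:
  fixes p :: "nat \<Rightarrow> (nat \<Rightarrow> 'h::banach) \<Rightarrow> real"
  assumes add: "\<And>i x y. \<lbrakk>x \<in> l2_space; y \<in> l2_space\<rbrakk> \<Longrightarrow> p i (\<lambda>k. x k + y k) \<le> p i x + p i y"
    and scale: "\<And>i r x. x \<in> l2_space \<Longrightarrow> p i (\<lambda>k. r *\<^sub>R x k) = \<bar>r\<bar> * p i x"
    and bounded: "\<And>i. \<exists>C. \<forall>x\<in>l2_space. p i x \<le> C * l2_norm x"
    and pointwise: "\<And>x. x \<in> l2_space \<Longrightarrow> \<exists>C. \<forall>i. p i x \<le> C"
  shows "\<exists>M. \<forall>i. \<forall>x\<in>l2_space. p i x \<le> M * l2_norm x"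
proof (rule ccontr)
  assume no: "\<not> ?thesis"
  have l2_scale: "(\<lambda>k. r *\<^sub>R x k) \<in> l2_space" "l2_norm (\<lambda>k. r *\<^sub>R x k) = \<bar>r\<bar> * l2_norm x"
    if "x \<in> l2_space" for r and x :: "nat \<Rightarrow> 'h"
    using l2_norm_homogeneous[OF that, of "\<lambda>k. r *\<^sub>R x k" "\<bar>r\<bar>"] by auto
  have zero: "(\<lambda>k. 0) \<in> (l2_space :: (nat \<Rightarrow> 'h) set)" "l2_norm (\<lambda>k. 0 :: 'h) = 0"
    by (simp_all add: l2_space_def l2_norm_def)
  have p0: "p i (\<lambda>k. 0) = 0" for i using scale[OF zero(1), of i 0] by simp
  define N where "N i = (SUP x\<in>{x \<in> l2_space. l2_norm x \<le> 1}. p i x)" for i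
  have bdd: "bdd_above (p i ` {x \<in> l2_space. l2_norm x \<le> 1})" for i
  proof -
    obtain C where C: "\<forall>x\<in>l2_space. p i x \<le> C * l2_norm x" using bounded by blast
    have "p i x \<le> \<bar>C\<bar>" if "x \<in> l2_space" "l2_norm x \<le> 1" for x
    proof -
      have "p i x \<le> C * l2_norm x" using C that by blast
      also have "\<dots> \<le> \<bar>C\<bar> * 1" using that l2_norm_nonneg[OF that(1)] by (intro mult_mono) auto
      finally show ?thesis by simp
    qed
    then show ?thesis by (intro bdd_aboveI2[where M = "\<bar>C\<bar>"]) auto
  qed
  have N0: "0 \<le> N i" for i
    unfolding N_def using cSUP_upper[OF _ bdd, of "\<lambda>k. 0"] zero p0 by simp
  have N: "p i x \<le> N i * l2_norm x" if x: "x \<in> l2_space" for i x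
  proof (cases "l2_norm x = 0")
    case True
    obtain C where "\<forall>x\<in>l2_space. p i x \<le> C * l2_norm x" using bounded by blast
    with x True show ?thesis by fastforce
  next
    case False
    then have pos: "0 < l2_norm x" using l2_norm_nonneg[OF x] by linarith
    have "p i (\<lambda>k. inverse (l2_norm x) *\<^sub>R x k) \<le> N i"
      unfolding N_def by (rule cSUP_upper[OF _ bdd]) (use l2_scale[OF x] pos in auto)
    then show ?thesis using pos by (simp add: scale[OF x] field_simps)
  qed
  have almost: "\<exists>w\<in>l2_space. l2_norm w \<le> 1 \<and> 2/3 * N i \<le> p i w" for i
  proof (cases "N i = 0")
    case True with zero p0 show ?thesis by (intro bexI[of _ "\<lambda>k. 0"]) auto
  next
    case False
    then have "2/3 * N i < N i" using N0[of i] by simp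
    then obtain w where "w \<in> l2_space" "l2_norm w \<le> 1" "2/3 * N i < p i w"
      unfolding N_def using less_cSUP_iff[OF _ bdd[of i]] zero by (smt (verit) empty_iff mem_Collect_eq)
    then show ?thesis by auto
  qed
  have "\<exists>i. 4 ^ n < N i" for n :: nat
  proof (rule ccontr)
    assume "\<not> ?thesis"
    then have le: "N i \<le> 4 ^ n" for i by (simp add: not_less)
    have "p i x \<le> 4 ^ n * l2_norm x" if "x \<in> l2_space" for i x
      using N[OF that, of i] mult_right_mono[OF le l2_norm_nonneg[OF that], of i] by linarith
    with no show False by blast
  qed
  then obtain \<iota> where \<iota>: "\<And>n::nat. 4 ^ n < N (\<iota> n)" by metis
  obtain w where w: "\<And>n. w n \<in> l2_space" "\<And>n. l2_norm (w n) \<le> 1"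
      "\<And>n. 2/3 * N (\<iota> n) \<le> p (\<iota> n) (w n)"
    using almost[of "\<iota> _"] by metis
  have step: "\<exists>y. y \<in> l2_space \<and> l2_norm (\<lambda>k. y k - x k) \<le> (1/3) ^ n
      \<and> (1/3) ^ n * (2/3 * N (\<iota> n)) \<le> p (\<iota> n) y" if x: "x \<in> l2_space" for x n
  proof -
    define v where "v \<sigma> = (\<lambda>k. (\<sigma> * (1/3) ^ n) *\<^sub>R w n k)" for \<sigma> :: real
    have v: "v \<sigma> \<in> l2_space" "l2_norm (v \<sigma>) \<le> (1/3) ^ n" if "\<bar>\<sigma>\<bar> = 1" for \<sigma>
      using l2_scale[OF w(1)[of n], of "\<sigma> * (1/3) ^ n"] w(2)[of n] that by (simp_all add: v_def abs_mult)
    define y where "y \<sigma> = (\<lambda>k. x k + v \<sigma> k)" for \<sigma>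
    have y: "y \<sigma> \<in> l2_space" "l2_norm (\<lambda>k. y \<sigma> k - x k) \<le> (1/3) ^ n" if "\<bar>\<sigma>\<bar> = 1" for \<sigma>
      using l2_norm_triangle(1)[OF x v(1)] v(2) that by (simp_all add: y_def)
    have "2 * ((1/3) ^ n * p (\<iota> n) (w n)) = p (\<iota> n) (\<lambda>k. (2 * (1/3) ^ n) *\<^sub>R w n k)"
      by (simp add: scale[OF w(1)])
    also have "(\<lambda>k. (2 * (1/3) ^ n) *\<^sub>R w n k) = (\<lambda>k. y 1 k + (-1) *\<^sub>R y (-1) k)"
      by (simp add: y_def v_def flip: scaleR_add_left)
    also have "p (\<iota> n) \<dots> \<le> p (\<iota> n) (y 1) + p (\<iota> n) (y (-1))"
      using add[OF y(1)[of 1] l2_scale(1)[OF y(1)[of "-1"]], of "\<iota> n" "-1"] scale[OF y(1)[of "-1"], of "\<iota> n" "-1"]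
      by simp
    finally have "(1/3) ^ n * p (\<iota> n) (w n) \<le> p (\<iota> n) (y 1) \<or> (1/3) ^ n * p (\<iota> n) (w n) \<le> p (\<iota> n) (y (-1))"
      by linarith
    then obtain \<sigma> :: real where \<sigma>: "\<bar>\<sigma>\<bar> = 1" "(1/3) ^ n * p (\<iota> n) (w n) \<le> p (\<iota> n) (y \<sigma>)"
      by (elim disjE) (auto intro: that[of 1] that[of "-1"])
    have "(1/3) ^ n * (2/3 * N (\<iota> n)) \<le> (1/3) ^ n * p (\<iota> n) (w n)"
      by (intro mult_left_mono w(3)) simp
    with \<sigma>(2) have "(1/3) ^ n * (2/3 * N (\<iota> n)) \<le> p (\<iota> n) (y \<sigma>)" by linarith
    with y[OF \<sigma>(1)] show ?thesis by blast
  qed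
  have "\<exists>X. \<forall>n. X n \<in> l2_space \<and> (l2_norm (\<lambda>k. X (Suc n) k - X n k) \<le> (1/3) ^ n
      \<and> (1/3) ^ n * (2/3 * N (\<iota> n)) \<le> p (\<iota> n) (X (Suc n)))"
    by (rule dependent_nat_choice) (use zero step in blast)+
  then obtain X where X: "\<And>n. X n \<in> l2_space" "\<And>n. l2_norm (\<lambda>k. X (Suc n) k - X n k) \<le> (1/3) ^ n"
      "\<And>n. (1/3) ^ n * (2/3 * N (\<iota> n)) \<le> p (\<iota> n) (X (Suc n))"
    by blast
  obtain x where x: "x \<in> l2_space" and tail: "\<And>n. (\<lambda>k. x k - X n k) \<in> l2_space"
      "\<And>n. l2_norm (\<lambda>k. x k - X n k) \<le> (\<Sum>j. (1/3) ^ (j + n))"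
    using l2_limit_of_summable_increments[where X = X, OF X(1,2)] by (auto simp: summable_geometric)
  \<comment> \<open>The tail after step \<open>n\<close> has norm at most \<open>1/2 * (1/3) ^ n\<close>, so it changes \<open>p (\<iota> n)\<close> by at most
    \<open>1/2 * (1/3) ^ n * N (\<iota> n)\<close>, less than the \<open>2/3 * (1/3) ^ n * N (\<iota> n)\<close> that the step secured.\<close>
  have geom: "(\<Sum>j. (1/3 :: real) ^ (j + n)) = 3/2 * (1/3) ^ n" for n
    by (simp add: power_add suminf_mult2[symmetric] summable_geometric suminf_geometric)
  have large: "1/6 * (4/3) ^ n \<le> p (\<iota> n) x" for n
  proof -
    let ?d = "\<lambda>k. x k - X (Suc n) k"
    have "p (\<iota> n) (X (Suc n)) = p (\<iota> n) (\<lambda>k. x k + (-1) *\<^sub>R ?d k)" by simp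
    also have "\<dots> \<le> p (\<iota> n) x + p (\<iota> n) ?d"
      using add[OF x l2_scale(1)[OF tail(1)], of "\<iota> n" "-1"] scale[OF tail(1), of "\<iota> n" "-1"] by simp
    also have "p (\<iota> n) ?d \<le> N (\<iota> n) * l2_norm ?d" by (rule N[OF tail(1)])
    also have "\<dots> \<le> N (\<iota> n) * (1/2 * (1/3) ^ n)"
      using tail(2)[of "Suc n", unfolded geom] by (intro mult_left_mono N0) simp
    finally have "(2/3) * ((1/3) ^ n * N (\<iota> n)) \<le> p (\<iota> n) x + 1/2 * ((1/3) ^ n * N (\<iota> n))"
      using X(3)[of n] by (simp add: mult_ac)
    moreover have "(1/3) ^ n * 4 ^ n \<le> (1/3) ^ n * N (\<iota> n)"
      using \<iota>[of n] by (intro mult_left_mono) auto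
    moreover have "(1/3 :: real) ^ n * 4 ^ n = (4/3) ^ n"
      by (simp flip: power_mult_distrib)
    ultimately show ?thesis by linarith
  qed
  obtain C where C: "\<And>i. p i x \<le> C" using pointwise[OF x] by blast
  obtain n where "6 * C < (4/3) ^ n" using real_arch_pow[of "4/3" "6 * C"] by auto
  with large[of n] C[of "\<iota> n"] show False by linarith
qed

text \<open>
  A matrix mapping on the direct sum is automatically bounded. The uniform boundedness principle is
  used twice. Applied to the partial sums of one row, it shows that each coordinate of \<open>E x\<close>
  depends boundedly on \<open>x\<close>; this makes the norms of the finite sections of \<open>E x\<close> bounded seminorms,
  to which it is applied again.
\<close>

lemma matrix_mapping_bounded:
  fixes sc :: "'k \<Rightarrow> 'h \<Rightarrow> 'h::banach" and E :: "nat \<Rightarrow> nat \<Rightarrow> 'k"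
  assumes sc: "\<And>a. bounded_linear (sc a)"
    and E: "matrix_mapping_on sc E l2_space"
  shows "\<exists>M. \<forall>x\<in>l2_space. l2_norm (matrix_apply sc E x) \<le> M * l2_norm x"
proof -
  have summ: "summable (\<lambda>k. sc (E n k) (x k))" if "x \<in> l2_space" for n x
    using E that by (auto simp: matrix_mapping_on_def matrix_defined_def)
  have maps: "matrix_apply sc E x \<in> l2_space" if "x \<in> l2_space" for x
    using E that by (auto simp: matrix_mapping_on_def)
  note lin = bounded_linear.linear[OF sc]
  have scadd: "sc a (x + y) = sc a x + sc a y" and scscale: "sc a (r *\<^sub>R x) = r *\<^sub>R sc a x" for a r x y
    by (simp_all add: linear_add[OF lin] linear_scale[OF lin])
  have row: "\<exists>M. \<forall>x\<in>l2_space. norm (matrix_apply sc E x n) \<le> M * l2_norm x" for n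
  proof -
    let ?p = "\<lambda>K x. norm (\<Sum>k<K. sc (E n k) (x k))"
    have "\<exists>M. \<forall>K. \<forall>x\<in>l2_space. ?p K x \<le> M * l2_norm x"
    proof (rule l2_uniform_boundedness)
      show "?p K (\<lambda>k. x k + y k) \<le> ?p K x + ?p K y" for K x y
        by (simp add: scadd sum.distrib norm_triangle_ineq)
      show "?p K (\<lambda>k. r *\<^sub>R x k) = \<bar>r\<bar> * ?p K x" for K r x
        by (simp add: scscale flip: scaleR_sum_right)
      show "\<exists>C. \<forall>x\<in>l2_space. ?p K x \<le> C * l2_norm x" for K
      proof (intro exI ballI)
        fix x :: "nat \<Rightarrow> 'h" assume x: "x \<in> l2_space"
        have "?p K x \<le> (\<Sum>k<K. onorm (sc (E n k)) * l2_norm x)"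
        proof (rule sum_norm_le)
          fix k
          have "norm (sc (E n k) (x k)) \<le> onorm (sc (E n k)) * norm (x k)" by (rule onorm[OF sc])
          also have "\<dots> \<le> onorm (sc (E n k)) * l2_norm x"
            by (intro mult_left_mono norm_le_l2_norm x onorm_pos_le sc)
          finally show "norm (sc (E n k) (x k)) \<le> onorm (sc (E n k)) * l2_norm x" .
        qed
        then show "?p K x \<le> (\<Sum>k<K. onorm (sc (E n k))) * l2_norm x" by (simp add: sum_distrib_right)
      qed
      show "\<exists>C. \<forall>K. ?p K x \<le> C" if "x \<in> l2_space" for x
      proof -
        have "Bseq (\<lambda>K. \<Sum>k<K. sc (E n k) (x k))"
          using summable_LIMSEQ[OF summ[OF that, of n]] by (intro convergent_imp_Bseq convergentI)
        then show ?thesis by (auto elim!: BseqE)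
      qed
    qed
    then obtain M where M: "\<And>K x. x \<in> l2_space \<Longrightarrow> ?p K x \<le> M * l2_norm x" by blast
    have "norm (matrix_apply sc E x n) \<le> M * l2_norm x" if x: "x \<in> l2_space" for x
      unfolding matrix_apply_def
      by (rule LIMSEQ_le_const2[OF tendsto_norm[OF summable_LIMSEQ[OF summ[OF x, of n]]]]) (use M[OF x] in blast)
    then show ?thesis by blast
  qed
  then obtain M where M: "\<And>n x. x \<in> l2_space \<Longrightarrow> norm (matrix_apply sc E x n) \<le> M n * l2_norm x"
    by metis
  let ?p = "\<lambda>m x. L2_set (\<lambda>n. norm (matrix_apply sc E x n)) {..<m}"
  have "\<exists>M. \<forall>m. \<forall>x\<in>l2_space. ?p m x \<le> M * l2_norm x"
  proof (rule l2_uniform_boundedness)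
    fix m and x y :: "nat \<Rightarrow> 'h" and r :: real
    assume x: "x \<in> l2_space"
    show "?p m (\<lambda>k. r *\<^sub>R x k) = \<bar>r\<bar> * ?p m x"
      using summ[OF x] by (simp add: matrix_apply_def scscale suminf_scaleR_right[symmetric] L2_set_right_distrib)
    assume y: "y \<in> l2_space"
    have "?p m (\<lambda>k. x k + y k) \<le> L2_set (\<lambda>n. norm (matrix_apply sc E x n) + norm (matrix_apply sc E y n)) {..<m}"
      using summ[OF x] summ[OF y]
      by (intro L2_set_mono) (auto simp: matrix_apply_def scadd suminf_add[symmetric] norm_triangle_ineq)
    also have "\<dots> \<le> ?p m x + ?p m y" by (rule L2_set_triangle_ineq)
    finally show "?p m (\<lambda>k. x k + y k) \<le> ?p m x + ?p m y" .
  next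
    show "\<exists>C. \<forall>x\<in>l2_space. ?p m x \<le> C * l2_norm x" for m
    proof (intro exI ballI)
      fix x :: "nat \<Rightarrow> 'h" assume x: "x \<in> l2_space"
      have "?p m x \<le> (\<Sum>n<m. norm (matrix_apply sc E x n))" by (rule L2_set_le_sum) simp
      also have "\<dots> \<le> (\<Sum>n<m. M n * l2_norm x)" by (intro sum_mono M x)
      finally show "?p m x \<le> (\<Sum>n<m. M n) * l2_norm x" by (simp add: sum_distrib_right)
    qed
    show "\<exists>C. \<forall>m. ?p m x \<le> C" if "x \<in> l2_space" for x
      using L2_set_le_l2_norm[OF maps[OF that]] by blast
  qed
  then obtain K where K: "\<And>m x. x \<in> l2_space \<Longrightarrow> ?p m x \<le> K * l2_norm x" by blast
  have "l2_norm (matrix_apply sc E x) \<le> K * l2_norm x" if "x \<in> l2_space" for x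
    by (rule l2_normI(2)[OF K[OF that]])
  then show ?thesis by blast
qed

text \<open>
  The supremum over the unit ball is an operator norm: by homogeneity it controls all vectors.
\<close>

lemma l2_matrix_norm_bound:
  fixes A :: "nat \<Rightarrow> nat \<Rightarrow> 'k::real_normed_field"
  assumes A: "l2_bounded_matrix A" and c: "c \<in> l2_space"
  shows "l2_norm (matrix_apply (*) A c) \<le> l2_matrix_norm A * l2_norm c"
proof -
  have summ: "summable (\<lambda>k. A n k * c k)" for n
    using A c by (auto simp: l2_bounded_matrix_def matrix_mapping_on_def matrix_defined_def)
  have Ac: "matrix_apply (*) A c \<in> l2_space"
    using A c by (auto simp: l2_bounded_matrix_def matrix_mapping_on_def)
  obtain M where M: "\<forall>c\<in>l2_space. l2_norm (matrix_apply (*) A c) \<le> M * l2_norm c"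
    using A by (auto simp: l2_bounded_matrix_def)
  show ?thesis
  proof (cases "l2_norm c = 0")
    case True with M c show ?thesis by fastforce
  next
    case False
    then have pos: "0 < l2_norm c" using l2_norm_nonneg[OF c] by linarith
    define t where "t = inverse (l2_norm c)"
    define d where "d = (\<lambda>k. of_real t * c k)"
    have t: "0 < t" "t * l2_norm c = 1" using pos by (auto simp: t_def)
    have d: "d \<in> l2_space" "l2_norm d = 1"
      using l2_norm_homogeneous[OF c, of d t] t by (auto simp: d_def norm_mult)
    have "matrix_apply (*) A d n = of_real t * matrix_apply (*) A c n" for n
      using suminf_mult[OF summ[of n], of "of_real t"] by (simp add: matrix_apply_def d_def mult_ac)
    then have "l2_norm (matrix_apply (*) A d) = t * l2_norm (matrix_apply (*) A c)"
      using l2_norm_homogeneous(2)[OF Ac, of "matrix_apply (*) A d" t] t by (simp add: norm_mult)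
    moreover have "l2_norm (matrix_apply (*) A d) \<le> l2_matrix_norm A"
      unfolding l2_matrix_norm_def
    proof (rule cSUP_upper)
      show "bdd_above ((\<lambda>c. l2_norm (matrix_apply (*) A c)) ` {c \<in> l2_space. l2_norm c \<le> 1})"
      proof (rule bdd_aboveI2[where M = "\<bar>M\<bar>"])
        fix c assume c: "c \<in> {c :: nat \<Rightarrow> 'k. c \<in> l2_space \<and> l2_norm c \<le> 1}"
        then have "l2_norm (matrix_apply (*) A c) \<le> M * l2_norm c" using M by blast
        also have "\<dots> \<le> \<bar>M\<bar> * 1" using c by (intro mult_mono) (auto simp: l2_norm_nonneg)
        finally show "l2_norm (matrix_apply (*) A c) \<le> \<bar>M\<bar>" by simp
      qed
    qed (use d in auto)
    ultimately have "t * l2_norm (matrix_apply (*) A c) \<le> l2_matrix_norm A" by simp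
    from mult_right_mono[OF this less_imp_le[OF pos]] show ?thesis
      using pos by (simp add: t_def field_simps)
  qed
qed

section \<open>Hilbert spaces over the real or complex scalars\<close>

lemma norm_sconj: "norm (sconj x) = norm (x :: 'k::real_or_complex)"
proof (cases "x = 0")
  case True
  then show ?thesis using sconj_of_real[of 0, where 'k='k] by simp
next
  case False
  have "norm x * norm (sconj x) = norm x * norm x"
    using arg_cong[OF mult_sconj[of x], of norm] by (simp add: norm_mult power2_eq_square del: of_real_power)
  with False show ?thesis by simp
qed

lemma bounded_linear_sconj: "bounded_linear (sconj :: 'k::real_or_complex \<Rightarrow> 'k)"
  by (rule bounded_linear_intro[where K = 1])
    (simp_all add: sconj_add sconj_mult sconj_of_real norm_sconj scaleR_conv_of_real)

context hilbert_space
begin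

lemma ip_add_right: "ip x (y + z) = ip x y + ip x z"
  using ip_sconj[of x "y + z"] ip_sconj[of x y] ip_sconj[of x z]
  by (simp add: ip_add_left sconj_add)

lemma ip_scale_right: "ip x (sc a y) = sconj a * ip x y"
  using ip_sconj[of x "sc a y"] ip_sconj[of x y] by (simp add: ip_scale_left sconj_mult)

lemma norm_sc: "norm (sc a x) = norm a * norm x"
proof -
  have "of_real ((norm (sc a x))\<^sup>2) = ip (sc a x) (sc a x)" by (rule ip_norm[symmetric])
  also have "\<dots> = (a * sconj a) * ip x x" by (simp add: ip_scale_left ip_scale_right mult_ac)
  also have "\<dots> = of_real ((norm a * norm x)\<^sup>2)"
    by (simp only: mult_sconj ip_norm power_mult_distrib of_real_mult)
  finally have "(norm (sc a x))\<^sup>2 = (norm a * norm x)\<^sup>2" by (simp only: of_real_eq_iff)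
  then show ?thesis by (simp add: power2_eq_iff_nonneg)
qed

lemma scaleR_eq_sc: "r *\<^sub>R x = sc (of_real r) x"
  by (simp add: scale_of_real)

lemma bounded_linear_sc_right: "bounded_linear (sc a)"
  by (rule bounded_linear_intro[where K = "norm a"])
    (simp_all add: scale_right_distrib scaleR_eq_sc mult.commute norm_sc)

lemma bounded_linear_sc_left: "bounded_linear (\<lambda>a. sc a x)"
  by (rule bounded_linear_intro[where K = "norm x"])
    (simp_all add: scale_left_distrib scaleR_eq_sc norm_sc scaleR_conv_of_real[where 'a='k])

text \<open>
  Cauchy--Schwarz, from the nonnegativity of the square norm of the component of \<open>x\<close> orthogonal
  to \<open>y\<close> (scaled by the square norm of \<open>y\<close>).
\<close>

lemma norm_ip_le: "norm (ip x y) \<le> norm x * norm y"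
proof (cases "y = 0")
  case True
  then show ?thesis using ip_scale_right[of x 0 y] sconj_of_real[of 0, where 'k='k] by simp
next
  case False
  define t where "t = ip x y"
  define b :: 'k where "b = of_real ((norm y)\<^sup>2)"
  define z where "z = sc b x + sc (- t) y"
  have zy: "ip z y = 0"
    by (simp add: z_def ip_add_left ip_scale_left ip_norm t_def b_def mult.commute
        del: of_real_power scale_minus_left)
  have "ip y z = sconj (ip z y)" by (rule ip_sconj)
  with zy have yz: "ip y z = 0" using sconj_of_real[of 0, where 'k='k] by simp
  have "ip y x = sconj t" unfolding t_def by (rule ip_sconj)
  then have "ip z x = of_real ((norm y)\<^sup>2 * (norm x)\<^sup>2 - (norm t)\<^sup>2)"
    by (simp add: z_def ip_add_left ip_scale_left ip_norm mult_sconj b_def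
        del: of_real_power scale_minus_left)
  then have xz: "ip x z = of_real ((norm y)\<^sup>2 * (norm x)\<^sup>2 - (norm t)\<^sup>2)"
    using ip_sconj[of x z] by (simp only: sconj_of_real)
  have "ip z z = b * ip x z - t * ip y z"
    by (subst (1) z_def) (simp add: ip_add_left ip_scale_left del: scale_minus_left)
  then have "of_real ((norm z)\<^sup>2) = (of_real ((norm y)\<^sup>2 * ((norm y)\<^sup>2 * (norm x)\<^sup>2 - (norm t)\<^sup>2)) :: 'k)"
    by (simp only: ip_norm yz xz b_def of_real_mult) simp
  then have "(norm z)\<^sup>2 = (norm y)\<^sup>2 * ((norm y)\<^sup>2 * (norm x)\<^sup>2 - (norm t)\<^sup>2)"
    by (simp only: of_real_eq_iff)
  then have "0 \<le> (norm y)\<^sup>2 * ((norm y)\<^sup>2 * (norm x)\<^sup>2 - (norm t)\<^sup>2)" by (metis zero_le_power2)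
  moreover have "0 < (norm y)\<^sup>2" using False by simp
  ultimately have "(norm t)\<^sup>2 \<le> (norm x * norm y)\<^sup>2"
    by (simp add: zero_le_mult_iff power_mult_distrib mult.commute)
  then show ?thesis unfolding t_def by (rule power2_le_imp_le) simp
qed

lemma bounded_linear_ip_left: "bounded_linear (\<lambda>x. ip x y)"
  by (rule bounded_linear_intro[where K = "norm y"])
    (simp_all add: ip_add_left scaleR_eq_sc ip_scale_left norm_ip_le scaleR_conv_of_real[where 'a='k])

lemma bounded_linear_ip_right: "bounded_linear (\<lambda>y. ip x y)"
proof -
  have "(\<lambda>y. ip x y) = (\<lambda>y. sconj (ip y x))" using ip_sconj by blast
  then show ?thesis
    using bounded_linear_compose[OF bounded_linear_sconj bounded_linear_ip_left[of x]] by simp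
qed

end

section \<open>Bessel sequences and matrices\<close>

context hilbert_space
begin

text \<open>
  The synthesis operator is the adjoint of the analysis operator \<open>f \<mapsto> (ip f (F k))\<^sub>k\<close>; testing a
  finite combination \<open>g\<close> against itself turns the Bessel bound into a bound for the norm of \<open>g\<close>.
  The absolute value keeps the square root meaningful: a Bessel bound can be negative in the zero
  space.
\<close>

lemma bessel_synthesis_bound:
  assumes F: "bessel_sequence ip F B" and A: "finite A"
  shows "norm (\<Sum>k\<in>A. sc (a k) (F k)) \<le> sqrt \<bar>B\<bar> * L2_set (\<lambda>k. norm (a k)) A"
proof -
  define g where "g = (\<Sum>k\<in>A. sc (a k) (F k))"
  have s: "summable (\<lambda>k. (norm (ip g (F k)))\<^sup>2)" and le: "(\<Sum>k. (norm (ip g (F k)))\<^sup>2) \<le> B * (norm g)\<^sup>2"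
    using F by (auto simp: bessel_sequence_def)
  have "(\<Sum>k\<in>A. (norm (ip g (F k)))\<^sup>2) \<le> (\<Sum>k. (norm (ip g (F k)))\<^sup>2)"
    by (rule sum_le_suminf[OF s A]) auto
  also note le
  also have "B * (norm g)\<^sup>2 \<le> \<bar>B\<bar> * (norm g)\<^sup>2" by (intro mult_right_mono) auto
  finally have "sqrt (\<Sum>k\<in>A. (norm (ip g (F k)))\<^sup>2) \<le> sqrt (\<bar>B\<bar> * (norm g)\<^sup>2)"
    by (rule real_sqrt_le_mono)
  then have L: "L2_set (\<lambda>k. norm (ip g (F k))) A \<le> sqrt \<bar>B\<bar> * norm g"
    by (simp add: L2_set_def real_sqrt_mult)
  have "ip g g = (\<Sum>k\<in>A. ip g (sc (a k) (F k)))"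
    by (subst (2) g_def) (rule linear_sum[OF bounded_linear.linear[OF bounded_linear_ip_right]])
  also have "\<dots> = (\<Sum>k\<in>A. sconj (a k) * ip g (F k))" by (simp add: ip_scale_right)
  finally have gg: "ip g g = (\<Sum>k\<in>A. sconj (a k) * ip g (F k))" .
  have "(norm g)\<^sup>2 = norm (ip g g)" by (simp add: ip_norm norm_power)
  also have "\<dots> \<le> (\<Sum>k\<in>A. \<bar>norm (a k)\<bar> * \<bar>norm (ip g (F k))\<bar>)"
    unfolding gg by (rule sum_norm_le) (simp add: norm_mult norm_sconj)
  also have "\<dots> \<le> L2_set (\<lambda>k. norm (a k)) A * L2_set (\<lambda>k. norm (ip g (F k))) A"
    by (rule L2_set_mult_ineq)
  also have "\<dots> \<le> L2_set (\<lambda>k. norm (a k)) A * (sqrt \<bar>B\<bar> * norm g)"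
    by (intro mult_left_mono L) simp
  finally have *: "norm g * norm g \<le> (sqrt \<bar>B\<bar> * L2_set (\<lambda>k. norm (a k)) A) * norm g"
    by (simp add: power2_eq_square mult_ac)
  have "norm g \<le> sqrt \<bar>B\<bar> * L2_set (\<lambda>k. norm (a k)) A"
  proof (cases "g = 0")
    case True then show ?thesis by simp
  next
    case False with * show ?thesis by simp
  qed
  then show ?thesis by (simp add: g_def)
qed

lemma bessel_synthesis_summable:
  assumes F: "bessel_sequence ip F B" and a: "a \<in> l2_space"
  shows "summable (\<lambda>k. sc (a k) (F k))"
  unfolding summable_Cauchy
proof (intro allI impI)
  fix e :: real assume e: "0 < e"
  define \<delta> where "\<delta> = e / (sqrt \<bar>B\<bar> + 1)"
  have b: "0 < sqrt \<bar>B\<bar> + 1" by (simp add: add_nonneg_pos)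
  then have \<delta>: "0 < \<delta>" using e by (simp add: \<delta>_def)
  have "summable (\<lambda>k. (norm (a k))\<^sup>2)" using a by (simp add: l2_space_def)
  then obtain N where N: "\<And>m n. N \<le> m \<Longrightarrow> norm (\<Sum>k=m..<n. (norm (a k))\<^sup>2) < \<delta>\<^sup>2"
    unfolding summable_Cauchy using \<delta> by (meson zero_less_power)
  have "norm (\<Sum>k=m..<n. sc (a k) (F k)) < e" if m: "N \<le> m" for m n
  proof -
    have "(\<Sum>k=m..<n. (norm (a k))\<^sup>2) < \<delta>\<^sup>2" using N[OF m, of n] by simp
    then have "L2_set (\<lambda>k. norm (a k)) {m..<n} < sqrt (\<delta>\<^sup>2)"
      unfolding L2_set_def by (rule real_sqrt_less_mono)
    then have L: "L2_set (\<lambda>k. norm (a k)) {m..<n} < \<delta>" using \<delta> by simp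
    have "norm (\<Sum>k=m..<n. sc (a k) (F k)) \<le> sqrt \<bar>B\<bar> * L2_set (\<lambda>k. norm (a k)) {m..<n}"
      by (rule bessel_synthesis_bound[OF F]) simp
    also have "\<dots> \<le> sqrt \<bar>B\<bar> * \<delta>" using L by (intro mult_left_mono) auto
    also have "\<dots> < (sqrt \<bar>B\<bar> + 1) * \<delta>" using \<delta> by simp
    also have "\<dots> = e" using b by (simp add: \<delta>_def)
    finally show ?thesis .
  qed
  then show "\<exists>N. \<forall>m\<ge>N. \<forall>n. norm (\<Sum>k=m..<n. sc (a k) (F k)) < e" by blast
qed

text \<open>
  A unit vector \<open>u\<close> embeds the scalar sequences isometrically into the direct sum, by \<open>c \<mapsto> (c\<^sub>k u)\<^sub>k\<close>,
  and this embedding commutes with the matrix. Testing against \<open>u\<close> shows that the scalar series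
  converge as well.
\<close>

lemma matrix_apply_along_unit_vector:
  assumes E: "matrix_mapping_on sc E l2_space" and u: "norm u = 1" and c: "c \<in> l2_space"
  shows "summable (\<lambda>k. E n k * c k)"
    and "matrix_apply sc E (\<lambda>k. sc (c k) u) n = sc (matrix_apply (*) E c n) u"
proof -
  have "(\<lambda>k. sc (c k) u) \<in> l2_space"
    using c l2_norm_cong(1)[of "\<lambda>k. sc (c k) u" c] by (simp add: norm_sc u)
  then have s: "summable (\<lambda>k. sc (E n k * c k) u)"
    using E by (auto simp: matrix_mapping_on_def matrix_defined_def)
  have "ip (sc a u) u = a" for a by (simp add: ip_scale_left ip_norm u)
  with bounded_linear.summable[OF bounded_linear_ip_left s, of u]
  show *: "summable (\<lambda>k. E n k * c k)" by simp
  show "matrix_apply sc E (\<lambda>k. sc (c k) u) n = sc (matrix_apply (*) E c n) u"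
    using bounded_linear.suminf[OF bounded_linear_sc_left *, of u] by (simp add: matrix_apply_def)
qed

lemma scalar_matrix_l2_bounded:
  fixes u :: 'h
  assumes E: "matrix_mapping_on sc E l2_space" and u: "norm u = 1"
  shows "l2_bounded_matrix E"
proof -
  obtain M where M: "\<And>x. x \<in> l2_space \<Longrightarrow> l2_norm (matrix_apply sc E x) \<le> M * l2_norm x"
    using matrix_mapping_bounded[OF bounded_linear_sc_right E] by blast
  have "matrix_apply (*) E c \<in> l2_space \<and> l2_norm (matrix_apply (*) E c) \<le> M * l2_norm c"
    if c: "c \<in> l2_space" for c
  proof -
    let ?x = "\<lambda>k. sc (c k) u"
    have x: "?x \<in> l2_space" "l2_norm ?x = l2_norm c"
      using c l2_norm_cong[of ?x c] by (simp_all add: norm_sc u)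
    have "norm (matrix_apply sc E ?x n) = norm (matrix_apply (*) E c n)" for n
      by (simp add: matrix_apply_along_unit_vector[OF E u c] norm_sc u)
    note eq = l2_norm_cong[OF this]
    have "matrix_apply sc E ?x \<in> l2_space" using E x(1) by (simp add: matrix_mapping_on_def)
    with M[OF x(1)] show ?thesis by (simp add: eq x(2))
  qed
  with matrix_apply_along_unit_vector(1)[OF E u] show ?thesis
    unfolding l2_bounded_matrix_def matrix_mapping_on_def matrix_defined_def
    by (intro conjI ballI allI exI[of _ M]) simp_all
qed

end

text \<open>
  Conjugation is an isometry of the sequence space, and the conjugate matrix is the original one
  conjugated by it.
\<close>

lemma l2_bounded_matrix_conj:
  fixes E :: "nat \<Rightarrow> nat \<Rightarrow> 'k::real_or_complex"
  assumes "l2_bounded_matrix E"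
  shows "l2_bounded_matrix (conj_matrix E)"
proof -
  obtain M where M: "\<And>c. c \<in> l2_space \<Longrightarrow> l2_norm (matrix_apply (*) E c) \<le> M * l2_norm c"
    using assms by (auto simp: l2_bounded_matrix_def)
  have "(\<forall>n. summable (\<lambda>k. conj_matrix E n k * c k)) \<and> matrix_apply (*) (conj_matrix E) c \<in> l2_space
      \<and> l2_norm (matrix_apply (*) (conj_matrix E) c) \<le> M * l2_norm c"
    if c: "c \<in> l2_space" for c :: "nat \<Rightarrow> 'k"
  proof -
    let ?d = "\<lambda>k. sconj (c k)"
    have d: "?d \<in> l2_space" "l2_norm ?d = l2_norm c"
      using c l2_norm_cong[of ?d c] by (simp_all add: norm_sconj)
    have s: "summable (\<lambda>k. E n k * ?d k)" and m: "matrix_apply (*) E ?d \<in> l2_space" for n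
      using assms d(1) by (auto simp: l2_bounded_matrix_def matrix_mapping_on_def matrix_defined_def)
    have term_eq: "sconj (E n k * ?d k) = conj_matrix E n k * c k" for n k
      by (simp add: sconj_mult sconj_conj conj_matrix_def)
    have "summable (\<lambda>k. conj_matrix E n k * c k)" for n
      using bounded_linear.summable[OF bounded_linear_sconj s[of n]] by (simp add: term_eq)
    moreover have "norm (matrix_apply (*) (conj_matrix E) c n) = norm (matrix_apply (*) E ?d n)" for n
      using bounded_linear.suminf[OF bounded_linear_sconj s[of n]] norm_sconj[of "matrix_apply (*) E ?d n"]
      by (simp add: term_eq matrix_apply_def)
    note eq = l2_norm_cong[OF this]
    ultimately show ?thesis using M[OF d(1)] m by (simp add: eq d(2))
  qed
  then show ?thesis
    unfolding l2_bounded_matrix_def matrix_mapping_on_def matrix_defined_def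
    by (intro conjI ballI allI exI[of _ M]) simp_all
qed

text \<open>
  The rows of a bounded matrix are square summable: apply the matrix to the conjugate of a finite
  section of the row, which turns the bound into \<open>s\<^sup>2 \<le> M * s\<close> for the norm \<open>s\<close> of the section.
\<close>

lemma l2_bounded_matrix_rows:
  fixes E :: "nat \<Rightarrow> nat \<Rightarrow> 'k::real_or_complex"
  assumes "l2_bounded_matrix E"
  shows "E n \<in> l2_space"
proof -
  obtain M where M: "\<And>c. c \<in> l2_space \<Longrightarrow> l2_norm (matrix_apply (*) E c) \<le> M * l2_norm c"
    using assms by (auto simp: l2_bounded_matrix_def)
  have "L2_set (\<lambda>k. norm (E n k)) {..<K} \<le> \<bar>M\<bar>" for K
  proof -
    define s where "s = L2_set (\<lambda>k. norm (E n k)) {..<K}"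
    define c where "c k = (if k < K then sconj (E n k) else 0)" for k
    have s2: "s\<^sup>2 = (\<Sum>k<K. (norm (E n k))\<^sup>2)" by (simp add: s_def L2_set_def sum_nonneg)
    have "(\<lambda>k. (norm (c k))\<^sup>2) sums (\<Sum>k<K. (norm (c k))\<^sup>2)"
      by (rule sums_finite) (auto simp: c_def)
    also have "(\<Sum>k<K. (norm (c k))\<^sup>2) = s\<^sup>2" by (simp add: s2 c_def norm_sconj)
    finally have c: "c \<in> l2_space" "l2_norm c = s"
      by (auto simp: l2_space_def l2_norm_def sums_iff s_def)
    have "matrix_apply (*) E c n = (\<Sum>k<K. E n k * c k)"
      unfolding matrix_apply_def by (rule suminf_finite) (auto simp: c_def)
    also have "\<dots> = of_real (s\<^sup>2)"
      unfolding s2 of_real_sum by (intro sum.cong) (auto simp: c_def mult_sconj)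
    finally have "norm (matrix_apply (*) E c n) = s\<^sup>2" by (simp del: of_real_power)
    moreover have "matrix_apply (*) E c \<in> l2_space"
      using assms c(1) by (auto simp: l2_bounded_matrix_def matrix_mapping_on_def)
    ultimately have "s\<^sup>2 \<le> M * s"
      using M[OF c(1)] norm_le_l2_norm[of "matrix_apply (*) E c" n] c(2) by simp
    moreover have "0 \<le> s" by (simp add: s_def)
    ultimately have "s \<le> \<bar>M\<bar>"
      by (cases "s = 0") (auto simp: power2_eq_square)
    then show ?thesis by (simp add: s_def)
  qed
  then show ?thesis by (rule l2_normI)
qed

text \<open>
  Pairing with \<open>f\<close> turns \<open>E F\<close> into the conjugate matrix applied to the coefficients
  \<open>ip f (F k)\<close>, because the inner product is conjugate linear in its second argument.
\<close>

lemma (in hilbert_space) bounded_matrix_of_bessel_sequence: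
  assumes F: "bessel_sequence ip F B" and E: "l2_bounded_matrix E"
  shows "E_bessel_sequence sc ip E F ((l2_matrix_norm (conj_matrix E))\<^sup>2 * B)"
proof -
  let ?N = "l2_matrix_norm (conj_matrix E)"
  have summ: "summable (\<lambda>k. sc (E n k) (F k))" for n
    by (rule bessel_synthesis_summable[OF F l2_bounded_matrix_rows[OF E]])
  have "summable (\<lambda>n. (norm (ip f (matrix_apply sc E F n)))\<^sup>2) \<and>
      (\<Sum>n. (norm (ip f (matrix_apply sc E F n)))\<^sup>2) \<le> ?N\<^sup>2 * B * (norm f)\<^sup>2" for f
  proof -
    define c where "c = (\<lambda>k. ip f (F k))"
    have c: "c \<in> l2_space" and cB: "(\<Sum>k. (norm (c k))\<^sup>2) \<le> B * (norm f)\<^sup>2"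
      using F by (auto simp: bessel_sequence_def l2_space_def c_def)
    have ip_EF: "ip f (matrix_apply sc E F n) = matrix_apply (*) (conj_matrix E) c n" for n
      using bounded_linear.suminf[OF bounded_linear_ip_right summ[of n], of f]
      by (simp add: matrix_apply_def ip_scale_right conj_matrix_def c_def)
    let ?y = "matrix_apply (*) (conj_matrix E) c"
    note bd = l2_bounded_matrix_conj[OF E]
    have y: "?y \<in> l2_space" using bd c by (auto simp: l2_bounded_matrix_def matrix_mapping_on_def)
    have sq: "(l2_norm x)\<^sup>2 = (\<Sum>k. (norm (x k))\<^sup>2)" if "x \<in> l2_space" for x :: "nat \<Rightarrow> 'k"
      using that by (simp add: l2_norm_def l2_space_def suminf_nonneg)
    have "(l2_norm ?y)\<^sup>2 \<le> (?N * l2_norm c)\<^sup>2"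
      by (intro power_mono l2_matrix_norm_bound[OF bd c] l2_norm_nonneg[OF y])
    also have "\<dots> \<le> ?N\<^sup>2 * (B * (norm f)\<^sup>2)"
      unfolding power_mult_distrib sq[OF c] by (intro mult_left_mono cB) simp
    finally show ?thesis using y by (simp add: sq[OF y] ip_EF l2_space_def mult.assoc)
  qed
  with summ show ?thesis
    by (simp add: E_bessel_sequence_def matrix_defined_def bessel_sequence_def)
qed

theorem corollary2p15:
  fixes sc :: "'k::real_or_complex \<Rightarrow> 'h::banach \<Rightarrow> 'h"
    and ip :: "'h \<Rightarrow> 'h \<Rightarrow> 'k"
    and F :: "nat \<Rightarrow> 'h"
    and E :: "nat \<Rightarrow> nat \<Rightarrow> 'k"
    and B :: real
  assumes "hilbert_space sc ip"
    and "separable_space (euclidean :: 'h topology)"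
    and "bessel_sequence ip F B"
    and "matrix_mapping_on sc E (l2_space :: (nat \<Rightarrow> 'h) set)"
  shows "((\<exists>x::'h. x \<noteq> 0) \<longrightarrow> l2_bounded_matrix (conj_matrix E)) \<and>
    E_bessel_sequence sc ip E F ((l2_matrix_norm (conj_matrix E))\<^sup>2 * B)"
proof (cases "\<exists>x::'h. x \<noteq> 0")
  case True
  interpret hilbert_space sc ip by fact
  from True obtain x :: 'h where "x \<noteq> 0" by blast
  then have "norm (inverse (norm x) *\<^sub>R x) = 1" by simp
  then have bd: "l2_bounded_matrix E" by (rule scalar_matrix_l2_bounded[OF assms(4)])
  show ?thesis
    using l2_bounded_matrix_conj[OF bd] bounded_matrix_of_bessel_sequence[OF assms(3) bd] by blast
next
  case False
  interpret hilbert_space sc ip by fact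
  have zero: "y = 0" for y :: 'h using False by blast
  have sc0: "sc a y = 0" and ip0: "ip y z = 0" for a y z
    using zero[of "sc a y"] norm_ip_le[of y z] zero[of y] by auto
  have norm0: "norm y = 0" for y :: 'h using zero[of y] by simp
  have "E_bessel_sequence sc ip E F C" for C
    by (simp add: E_bessel_sequence_def matrix_defined_def bessel_sequence_def sc0 ip0 norm0)
  with False show ?thesis by blast
qed

end
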